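(* Let $\alpha>1$ be a real algebraic number whose minimal polynomial over $\mathbb{Q}$ is $\mathfrak{m}_\alpha(X)=X^3+aX^2-bX-c$ with $a,b,c$ positive integers, and suppose that $\alpha$ is the unique positive root of $\mathfrak{m}_\alpha$. If the additive monoid $\mathbb{N}_0[\alpha]$ is finitely generated, then $b\ge a^2$ and $b^3\ge a^3c$.
   Context: $\mathbb{N}_0=\{0,1,2,\dots\}$. For $\alpha\in\mathbb{R}_{>0}$, $\mathbb{N}_0[\alpha]=\{f(\alpha): f(X)\in\mathbb{N}_0[X]\}\subseteq\mathbb{R}_{\ge 0}$, viewed as a commutative monoid under addition. A commutative monoid $(M,+,0)$ is finitely generated if there is a finite subset $S\subseteq M$ such that every element of $M$ is a finite (possibly empty) sum of elements of $S$. *)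

theory Defs
  imports
    Complex_Main
    "HOL-Library.Multiset"
    "HOL-Computational_Algebra.Polynomial"
begin

text \<open>The set \<open>\<nat>\<^sub>0[\<alpha>]\<close> of values at \<open>\<alpha>\<close> of polynomials with natural number coefficients.\<close>

definition nat_adjoin :: "real \<Rightarrow> real set" where
  "nat_adjoin \<alpha> = {poly (map_poly of_nat f) \<alpha> | f :: nat poly. True}"

lemma nat_adjoin_0: "0 \<in> nat_adjoin \<alpha>"
  unfolding nat_adjoin_def by (auto intro!: exI[of _ 0])

lemma nat_adjoin_add:
  assumes "x \<in> nat_adjoin \<alpha>" "y \<in> nat_adjoin \<alpha>"
  shows "x + y \<in> nat_adjoin \<alpha>"
proof -
  obtain f g :: "nat poly" where "x = poly (map_poly of_nat f) \<alpha>" "y = poly (map_poly of_nat g) \<alpha>"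
    using assms unfolding nat_adjoin_def by auto
  moreover have "map_poly of_nat (f + g) = (map_poly of_nat f + map_poly of_nat g :: real poly)"
    by (rule poly_eqI) (simp add: coeff_map_poly)
  ultimately have "x + y = poly (map_poly of_nat (f + g)) \<alpha>"
    by simp
  then show ?thesis
    unfolding nat_adjoin_def by blast
qed

text \<open>
  Finite generation of a submonoid \<open>M\<close> of an additive commutative monoid. A finite sum of
  elements of \<open>S\<close>, with repetitions allowed, is the sum of a multiset supported on \<open>S\<close>;
  the empty multiset gives the empty sum.
\<close>

definition finitely_generated_monoid :: "'a :: comm_monoid_add set \<Rightarrow> bool" where
  "finitely_generated_monoid M \<longleftrightarrow>
     (\<exists>S. finite S \<and> S \<subseteq> M \<and> (\<forall>x\<in>M. \<exists>A. set_mset A \<subseteq> S \<and> x = sum_mset A))"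

text \<open>\<open>p\<close> is the monic polynomial of least degree over \<open>\<rat>\<close> vanishing at \<open>x\<close>.\<close>

definition is_minimal_poly :: "rat poly \<Rightarrow> 'a :: field_char_0 \<Rightarrow> bool" where
  "is_minimal_poly p x \<longleftrightarrow>
     lead_coeff p = 1 \<and> poly (map_poly of_rat p) x = 0 \<and>
     (\<forall>q. q \<noteq> 0 \<and> poly (map_poly of_rat q) x = 0 \<longrightarrow> degree p \<le> degree q)"

lemma is_minimal_poly_unique:
  assumes "is_minimal_poly p x" "is_minimal_poly q x"
  shows "p = q"
proof (rule ccontr)
  assume "p \<noteq> q"
  have deg: "degree p = degree q"
    using assms unfolding is_minimal_poly_def by (metis antisym coeff_0 zero_neq_one)
  have "map_poly of_rat (p - q) = (map_poly of_rat p - map_poly of_rat q :: 'a poly)"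
    by (rule poly_eqI) (simp add: coeff_map_poly of_rat_diff)
  then have "poly (map_poly of_rat (p - q)) x = 0"
    using assms by (simp add: is_minimal_poly_def)
  then have le: "degree p \<le> degree (p - q)"
    using assms(1) \<open>p \<noteq> q\<close> by (simp add: is_minimal_poly_def)
  have "coeff (p - q) (degree p) = 0"
    using assms deg by (simp add: is_minimal_poly_def)
  moreover have "degree (p - q) \<le> degree p"
    using deg by (simp add: degree_diff_le)
  ultimately show False
    using le \<open>p \<noteq> q\<close> by (metis antisym eq_iff_diff_eq_0 leading_coeff_0_iff)
qed

end

theory Submission
  imports Defs
begin

text \<open>
  Finite generation yields a relation \<open>\<alpha>\<^sup>n = g(\<alpha>)\<close> with \<open>g\<close> having natural coefficients and degree
  below \<open>n\<close>. The minimal polynomial divides \<open>X\<^sup>n - g(X)\<close>, so each conjugate \<open>z\<close> of \<open>\<alpha>\<close> satisfies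
  \<open>z\<^sup>n = g(z)\<close>, which forces \<open>\<bar>z\<bar> \<le> \<alpha>\<close>. For the two other conjugates \<open>\<beta>\<close>, \<open>\<gamma>\<close> we have
  \<open>\<beta> + \<gamma> = -(a + \<alpha>)\<close> and \<open>\<beta>\<gamma> = c / \<alpha>\<close>, whence \<open>a \<le> \<alpha>\<close> and \<open>c \<le> \<alpha>\<^sup>3\<close>. By the cubic equation the
  latter means \<open>a \<alpha> \<le> b\<close>, and both conclusions follow.
\<close>

lemma map_poly_of_nat_add:
  "map_poly of_nat (f + g) = (map_poly of_nat f + map_poly of_nat g :: 'a :: semiring_1 poly)"
  by (rule poly_eqI) (simp add: coeff_map_poly)

lemma map_poly_of_rat_add:
  "map_poly of_rat (p + q) = (map_poly of_rat p + map_poly of_rat q :: 'a :: field_char_0 poly)"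
  by (rule poly_eqI) (simp add: coeff_map_poly of_rat_add)

lemma map_poly_of_rat_mult:
  "map_poly of_rat (p * q) = (map_poly of_rat p * map_poly of_rat q :: 'a :: field_char_0 poly)"
  by (rule poly_eqI) (simp add: coeff_map_poly coeff_mult of_rat_sum of_rat_mult)

text \<open>The remainder of \<open>p\<close> modulo \<open>m\<close> also vanishes at
  \<open>x\<close>; if nonzero, it would have degree below that of \<open>m\<close>, against
  minimality.\<close>

lemma is_minimal_poly_dvd:
  assumes "is_minimal_poly m x" and "poly (map_poly of_rat p) x = 0"
  shows "m dvd p"
proof (rule ccontr)
  assume ndvd: "\<not> m dvd p"
  then have r: "p mod m \<noteq> 0"
    by (simp add: mod_eq_0_iff_dvd)
  have "m \<noteq> 0"
    using assms(1) by (auto simp: is_minimal_poly_def)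
  have "poly (map_poly of_rat (p div m * m + p mod m)) x = 0"
    using assms(2) by simp
  then have "poly (map_poly of_rat (p mod m)) x = 0"
    using assms(1) by (simp only: map_poly_of_rat_add map_poly_of_rat_mult)
      (simp add: is_minimal_poly_def)
  then have "degree m \<le> degree (p mod m)"
    using assms(1) r by (simp add: is_minimal_poly_def)
  with degree_mod_less'[OF \<open>m \<noteq> 0\<close> r] show False
    by simp
qed

text \<open>The rational polynomial \<open>X^n - g\<close> vanishes at \<open>x\<close>, so
  \<open>m\<close> divides it and it vanishes at every root of \<open>m\<close>. The two field types
  differ so that a relation for a real number transfers to its complex conjugates.\<close>

lemma conjugate_satisfies_monomial_relation:
  fixes x :: "'a :: field_char_0" and z :: "'b :: field_char_0" and g :: "nat poly"
  assumes "is_minimal_poly m x" and "poly (map_poly of_rat m) z = 0"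
    and "x ^ n = poly (map_poly of_nat g) x"
  shows "z ^ n = poly (map_poly of_nat g) z"
proof -
  define p :: "rat poly" where "p = monom 1 n - map_poly of_nat g"
  have p: "map_poly of_rat p = (monom 1 n - map_poly of_nat g :: 'c :: field_char_0 poly)"
    by (rule poly_eqI) (simp add: p_def coeff_map_poly of_rat_diff)
  have "m dvd p"
    using assms(1,3) by (intro is_minimal_poly_dvd[of m x]) (auto simp: p poly_monom)
  then obtain q where "p = m * q" ..
  then have "poly (map_poly of_rat p) z = 0"
    using assms(2) by (simp add: map_poly_of_rat_mult)
  then show ?thesis
    by (simp add: p poly_monom)
qed

text \<open>Finitely many generators are values of polynomials of degree at most some
  \<open>N\<close>. Sums keep this bound, so it also holds for a polynomial representing the power
  with exponent \<open>N + 1\<close>.\<close>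

lemma finitely_generated_nat_adjoin_relation:
  assumes "finitely_generated_monoid (nat_adjoin \<alpha>)"
  obtains n and g :: "nat poly"
  where "\<alpha> ^ n = poly (map_poly of_nat g) \<alpha>" and "degree g < n"
proof -
  obtain S where S: "finite S" "S \<subseteq> nat_adjoin \<alpha>"
    and gen: "\<And>x. x \<in> nat_adjoin \<alpha> \<Longrightarrow> \<exists>A. set_mset A \<subseteq> S \<and> x = sum_mset A"
    using assms unfolding finitely_generated_monoid_def by blast
  have "\<forall>s\<in>S. \<exists>f :: nat poly. s = poly (map_poly of_nat f) \<alpha>"
    using S(2) unfolding nat_adjoin_def by blast
  then obtain F :: "real \<Rightarrow> nat poly" where F: "\<And>s. s \<in> S \<Longrightarrow> s = poly (map_poly of_nat (F s)) \<alpha>"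
    by metis
  \<comment> \<open>The inserted 0 keeps \<open>Max\<close> meaningful when \<open>S\<close> is
    empty.\<close>
  define N where "N = Max (insert 0 ((\<lambda>s. degree (F s)) ` S))"
  have N: "degree (F s) \<le> N" if "s \<in> S" for s
    unfolding N_def using S(1) that by (intro Max_ge) auto
  have sums: "\<exists>g :: nat poly. sum_mset A = poly (map_poly of_nat g) \<alpha> \<and> degree g \<le> N"
    if "set_mset A \<subseteq> S" for A
    using that
  proof (induction A)
    case empty
    show ?case by (auto intro!: exI[of _ 0])
  next
    case (add s A)
    then obtain g :: "nat poly" where "sum_mset A = poly (map_poly of_nat g) \<alpha>" "degree g \<le> N"
      by auto
    then show ?case
      using add.prems F[of s] N[of s]
      by (intro exI[of _ "F s + g"]) (auto simp: map_poly_of_nat_add degree_add_le)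
  qed
  have "map_poly of_nat (monom 1 (Suc N)) = (monom 1 (Suc N) :: real poly)"
    by (rule poly_eqI) (simp add: coeff_map_poly)
  then have "\<alpha> ^ Suc N = poly (map_poly of_nat (monom 1 (Suc N))) \<alpha>"
    by (simp add: poly_monom)
  then have "\<alpha> ^ Suc N \<in> nat_adjoin \<alpha>"
    unfolding nat_adjoin_def by blast
  from gen[OF this] sums obtain g :: "nat poly"
    where "\<alpha> ^ Suc N = poly (map_poly of_nat g) \<alpha>" "degree g \<le> N"
    by metis
  then show ?thesis
    by (intro that[of "Suc N" g]) auto
qed

lemma poly_map_of_nat_altdef:
  fixes x :: "'a :: {comm_semiring_1, semiring_char_0}"
  shows "poly (map_poly of_nat g) x = (\<Sum>i\<le>degree g. of_nat (coeff g i) * x ^ i)"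
  by (simp add: poly_altdef degree_map_poly coeff_map_poly)

text \<open>With r = |z|, the triangle inequality gives r^n \<le> g(r). Since deg g < n, the
  quotient g(t)/t^n decreases in t and equals 1 at \<alpha>, so r cannot exceed \<alpha>.\<close>

lemma norm_le_of_monomial_relation:
  fixes \<alpha> :: real and z :: "'a :: real_normed_field" and g :: "nat poly"
  assumes "\<alpha> > 0" and deg: "degree g < n"
    and \<alpha>: "\<alpha> ^ n = poly (map_poly of_nat g) \<alpha>"
    and z: "z ^ n = poly (map_poly of_nat g) z"
  shows "norm z \<le> \<alpha>"
proof (rule ccontr)
  define r where "r = norm z"
  assume "\<not> norm z \<le> \<alpha>"
  then have r: "r > \<alpha>" "r > 0"
    using assms(1) by (auto simp: r_def)
  have "r ^ n = norm (\<Sum>i\<le>degree g. of_nat (coeff g i) * z ^ i)"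
    using z by (simp add: r_def poly_map_of_nat_altdef flip: norm_power)
  also have "\<dots> \<le> (\<Sum>i\<le>degree g. real (coeff g i) * r ^ i)"
    by (rule sum_norm_le) (simp add: r_def norm_mult norm_power)
  \<comment> \<open>Multiplying by \<open>\<alpha> ^ n\<close> avoids quotients. The extra factor
    \<open>r\<close>, later traded for \<alpha>, makes the final inequality contradict r >
    \<alpha>.\<close>
  finally have "r ^ n * (r * \<alpha> ^ n) \<le> (\<Sum>i\<le>degree g. real (coeff g i) * r ^ i) * (r * \<alpha> ^ n)"
    using r assms(1) by (intro mult_right_mono) auto
  also have "\<dots> = (\<Sum>i\<le>degree g. real (coeff g i) * (r ^ Suc i * \<alpha> ^ n))"
    by (simp add: sum_distrib_left sum_distrib_right mult_ac)
  also have "\<dots> \<le> (\<Sum>i\<le>degree g. real (coeff g i) * (\<alpha> ^ Suc i * r ^ n))"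
  proof (intro sum_mono mult_left_mono)
    fix i assume "i \<in> {..degree g}"
    \<comment> \<open>Here deg g < n is essential: it leaves room for the extra factor in
      \<open>Suc i\<close>.\<close>
    then have n: "n = Suc i + (n - Suc i)"
      using deg by simp
    have "\<alpha> ^ (n - Suc i) \<le> r ^ (n - Suc i)"
      using r assms(1) by (intro power_mono) auto
    then have "(r ^ Suc i * \<alpha> ^ Suc i) * \<alpha> ^ (n - Suc i) \<le> (r ^ Suc i * \<alpha> ^ Suc i) * r ^ (n - Suc i)"
      using r assms(1) by (intro mult_left_mono) auto
    then show "r ^ Suc i * \<alpha> ^ n \<le> \<alpha> ^ Suc i * r ^ n"
      by (subst (1 2) n) (simp only: power_add mult_ac)
  qed auto
  also have "\<dots> = \<alpha> ^ n * (\<alpha> * r ^ n)"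
    unfolding \<alpha> poly_map_of_nat_altdef by (simp add: sum_distrib_left sum_distrib_right mult_ac)
  finally have "r * (r ^ n * \<alpha> ^ n) \<le> \<alpha> * (r ^ n * \<alpha> ^ n)"
    by (simp add: mult_ac)
  then show False
    using r assms(1) by (simp add: mult_le_cancel_right)
qed

lemma complex_quadratic_Vieta:
  fixes s p :: complex
  obtains \<beta> \<gamma> where "\<beta> + \<gamma> = s" and "\<beta> * \<gamma> = p"
proof
  let ?d = "csqrt (s\<^sup>2 - 4 * p)"
  show "(s + ?d) / 2 + (s - ?d) / 2 = s"
    by (simp add: field_simps)
  have "(s + ?d) * (s - ?d) = s\<^sup>2 - ?d\<^sup>2"
    by (simp add: algebra_simps power2_eq_square)
  then show "(s + ?d) / 2 * ((s - ?d) / 2) = p"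
    by simp
qed

theorem proposition12:
  fixes \<alpha> :: real and a b c :: int and m :: "rat poly"
  assumes "\<alpha> > 1" and "algebraic \<alpha>"
    and "a > 0" and "b > 0" and "c > 0"
    and "m = [:- of_int c, - of_int b, of_int a, 1:]"
    and "is_minimal_poly m \<alpha>"
    and "\<forall>x::real. x > 0 \<and> poly (map_poly of_rat m) x = 0 \<longleftrightarrow> x = \<alpha>"
    and "finitely_generated_monoid (nat_adjoin \<alpha>)"
  shows "b \<ge> a ^ 2 \<and> b ^ 3 \<ge> a ^ 3 * c"
proof -
  obtain n and g :: "nat poly"
    where g: "\<alpha> ^ n = poly (map_poly of_nat g) \<alpha>" "degree g < n"
    using finitely_generated_nat_adjoin_relation[OF assms(9)] .
  have m: "poly (map_poly of_rat m) z = z ^ 3 + of_int a * z ^ 2 - of_int b * z - of_int c"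
    for z :: "'a :: field_char_0"
    by (simp add: assms(6) map_poly_pCons of_rat_minus algebra_simps power2_eq_square power3_eq_cube)
  have norm_le: "norm z \<le> \<alpha>" if "poly (map_poly of_rat m) z = 0" for z :: complex
    using conjugate_satisfies_monomial_relation[OF assms(7) that g(1)] assms(1) g
    by (intro norm_le_of_monomial_relation) auto
  have cubic: "\<alpha> ^ 3 + a * \<alpha> ^ 2 - b * \<alpha> - c = 0"
    using assms(7) m[of \<alpha>] by (simp add: is_minimal_poly_def)
  \<comment> \<open>Vieta prescribes these values: the three roots of the cubic have sum -a and
    product c.\<close>
  obtain \<beta> \<gamma> where sum: "\<beta> + \<gamma> = - complex_of_real (a + \<alpha>)"
    and prod: "\<beta> * \<gamma> = complex_of_real (c / \<alpha>)"
    using complex_quadratic_Vieta .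
  have "of_int b * \<alpha> = (\<alpha>\<^sup>2 + a * \<alpha> - c / \<alpha>) * \<alpha>"
    using cubic assms(1) by (simp add: algebra_simps power2_eq_square power3_eq_cube)
  then have b: "of_int b = \<alpha>\<^sup>2 + a * \<alpha> - c / \<alpha>"
    using assms(1) by simp
  have factor: "poly (map_poly of_rat m) z = (z - of_real \<alpha>) * ((z - \<beta>) * (z - \<gamma>))" for z
  proof -
    define t where "t = complex_of_real (c / \<alpha>)"
    have b': "complex_of_int b = of_real \<alpha> ^ 2 + of_int a * of_real \<alpha> - t"
      using arg_cong[OF b, of complex_of_real] by (simp add: t_def)
    have c': "complex_of_int c = of_real \<alpha> * t"
      using assms(1) by (simp add: t_def)
    have "(z - \<beta>) * (z - \<gamma>) = z\<^sup>2 - (\<beta> + \<gamma>) * z + \<beta> * \<gamma>"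
      by (simp add: algebra_simps power2_eq_square)
    also have "\<dots> = z\<^sup>2 + (of_int a + of_real \<alpha>) * z + t"
      by (simp add: sum prod t_def algebra_simps)
    finally have quadratic: "(z - \<beta>) * (z - \<gamma>) = \<dots>" .
    show ?thesis
      unfolding m quadratic b' c' by (simp add: algebra_simps power2_eq_square power3_eq_cube)
  qed
  have le: "norm \<beta> \<le> \<alpha>" "norm \<gamma> \<le> \<alpha>"
    by (auto intro!: norm_le simp: factor)
  \<comment> \<open>The sum of the two conjugates is real and negative, so its norm is a +
    \<alpha>.\<close>
  have "a + \<alpha> = norm (\<beta> + \<gamma>)"
    using assms(1,3) unfolding sum norm_minus_cancel norm_of_real by simp
  also have "\<dots> \<le> 2 * \<alpha>"
    using norm_triangle_ineq[of \<beta> \<gamma>] le by simp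
  finally have a_le: "a \<le> \<alpha>"
    by simp
  have "c / \<alpha> = norm (\<beta> * \<gamma>)"
    using assms(1,5) unfolding prod norm_of_real by simp
  also have "\<dots> \<le> \<alpha> * \<alpha>"
    unfolding norm_mult using le assms(1) by (intro mult_mono) auto
  finally have c_div_le: "c / \<alpha> \<le> \<alpha> * \<alpha>" .
  then have c_le: "c \<le> \<alpha> ^ 3"
    using assms(1) by (simp add: pos_divide_le_eq power3_eq_cube)
  \<comment> \<open>In the formula for b, the term c/\<alpha> is at most the square of \<alpha>,
    leaving at least a\<alpha>.\<close>
  have b_ge: "a * \<alpha> \<le> b"
    using b c_div_le by (simp add: power2_eq_square)
  have "real_of_int (a\<^sup>2) \<le> a * \<alpha>"
    using a_le assms(3) by (simp add: power2_eq_square)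
  then have "real_of_int (a\<^sup>2) \<le> b"
    using b_ge by linarith
  moreover have "real_of_int (a ^ 3 * c) \<le> of_int (b ^ 3)"
  proof -
    have "real_of_int (a ^ 3 * c) \<le> (a * \<alpha>) ^ 3"
      using c_le assms(3) by (simp add: power_mult_distrib)
    also have "\<dots> \<le> of_int b ^ 3"
      using b_ge assms(1,3) by (intro power_mono) auto
    finally show ?thesis by simp
  qed
  ultimately show ?thesis
    by (simp only: of_int_le_iff)
qed

end
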